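(* Let $A$ be an infinite set, written as a union $A=\bigcup_{\alpha\in\mathcal{A}}A_\alpha$ of pairwise disjoint countably infinite sets $A_\alpha=\{x_{\alpha,i} : i\in\mathbb{N}\}$ (each enumerated without repetition), and let $C=\{0,1\}^A$ be the Cantor space over $A$ with topology $\mathcal{T}_C$. If $\sigma:C\to C$ is defined by $(\sigma f)(x_{\alpha,i})=f(x_{\alpha,i+1})$ for all $f\in C$, $\alpha\in\mathcal{A}$, $i\in\mathbb{N}$, then $\sigma$ is chaotic on $C$.
   Context: $\mathbb{N}=\{1,2,3,\dots\}$. Cantor space over $A$: $C=\{0,1\}^A$ is the set of all functions from $A$ to $\{0,1\}$. For each finite set $B\subset A$ and each map $\phi\in\{0,1\}^B$, let $N(B,\phi)=\{f\in C : f(x)=\phi(x)\text{ for all }x\in B\}$. $\mathcal{T}_C$ is the topology on $C$ having the sets $N(B,\phi)$ ($B\subset A$ finite, $\phi\in\{0,1\}^B$) as a basis. For a map $g:X\to X$, the forward orbit of $x$ is $O(x)=\{x,g(x),g^2(x),\dots\}$, and a point $p$ is periodic if $g^n(p)=p$ for some positive integer $n$. Chaotic: a map $g:X\to X$ of a topological space is chaotic on $X$ if it is continuous and for any two nonvoid open subsets $U,V$ of $X$ there is a periodic point $p\in X$ of $g$ such that $U\cap O(p)\neq\emptyset$ and $V\cap O(p)\neq\emptyset$. *)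

theory Defs
  imports "HOL-Analysis.Analysis"
begin

definition cantor_space :: "'a set \<Rightarrow> ('a \<Rightarrow> nat) set" where
  "cantor_space A = A \<rightarrow>\<^sub>E {0, 1}"

definition cantor_nbhd :: "'a set \<Rightarrow> 'a set \<Rightarrow> ('a \<Rightarrow> nat) \<Rightarrow> ('a \<Rightarrow> nat) set" where
  "cantor_nbhd A B \<phi> = {f \<in> cantor_space A. \<forall>x\<in>B. f x = \<phi> x}"

definition cantor_basis :: "'a set \<Rightarrow> ('a \<Rightarrow> nat) set set" where
  "cantor_basis A = {cantor_nbhd A B \<phi> | B \<phi>. finite B \<and> B \<subseteq> A \<and> \<phi> \<in> B \<rightarrow>\<^sub>E {0, 1}}"

definition cantor_topology :: "'a set \<Rightarrow> ('a \<Rightarrow> nat) topology" where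
  "cantor_topology A = topology (arbitrary union_of (\<lambda>U. U \<in> cantor_basis A))"

(* The operator topology is only meaningful on families satisfying istopology,
   so it has to be checked that unions of basic sets do form a topology. *)

lemma openin_cantor_topology:
  "openin (cantor_topology A) = arbitrary union_of (\<lambda>U. U \<in> cantor_basis A)"
proof -
  have inter: "(arbitrary union_of (\<lambda>U. U \<in> cantor_basis A)) (S \<inter> T)"
    if S: "S \<in> cantor_basis A" and T: "T \<in> cantor_basis A" for S T
  proof (cases "S \<inter> T = {}")
    case True
    then show ?thesis by simp
  next
    case False
    then obtain f where f: "f \<in> S" "f \<in> T" by blast
    obtain B \<phi> where B: "S = cantor_nbhd A B \<phi>" "finite B" "B \<subseteq> A"
      using S by (auto simp: cantor_basis_def)
    obtain D \<psi> where D: "T = cantor_nbhd A D \<psi>" "finite D" "D \<subseteq> A"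
      using T by (auto simp: cantor_basis_def)
    have fC: "f \<in> A \<rightarrow>\<^sub>E {0, 1}"
      and fB: "\<And>x. x \<in> B \<Longrightarrow> f x = \<phi> x" and fD: "\<And>x. x \<in> D \<Longrightarrow> f x = \<psi> x"
      using f B(1) D(1) by (auto simp: cantor_nbhd_def cantor_space_def)
    have "S \<inter> T = cantor_nbhd A (B \<union> D) (restrict f (B \<union> D))"
      unfolding B(1) D(1) cantor_nbhd_def using fB fD by auto
    moreover have "restrict f (B \<union> D) \<in> (B \<union> D) \<rightarrow>\<^sub>E {0, 1}"
      using fC B(3) D(3) by (intro restrict_PiE_iff[THEN iffD2]) (auto simp: PiE_iff)
    ultimately have "S \<inter> T \<in> cantor_basis A"
      using B(2,3) D(2,3) unfolding cantor_basis_def by blast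
    then show ?thesis by (simp add: arbitrary_union_of_inc)
  qed
  have "istopology (arbitrary union_of (\<lambda>U. U \<in> cantor_basis A))"
    unfolding istopology_base_eq
    using inter by (simp add: arbitrary_union_of_Int_eq)
  then show ?thesis
    by (simp add: cantor_topology_def topology_inverse')
qed

lemma topspace_cantor_topology: "topspace (cantor_topology A) = cantor_space A"
proof
  show "topspace (cantor_topology A) \<subseteq> cantor_space A"
    unfolding topspace_def openin_cantor_topology
    by (auto simp: union_of_def cantor_basis_def cantor_nbhd_def subset_iff)
  have "cantor_space A = cantor_nbhd A {} (\<lambda>_. undefined)"
    by (simp add: cantor_nbhd_def)
  then have "cantor_space A \<in> cantor_basis A"
    unfolding cantor_basis_def by fastforce
  then have "openin (cantor_topology A) (cantor_space A)"
    by (simp add: openin_cantor_topology arbitrary_union_of_inc)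
  then show "cantor_space A \<subseteq> topspace (cantor_topology A)"
    by (rule openin_subset)
qed

definition forward_orbit :: "('b \<Rightarrow> 'b) \<Rightarrow> 'b \<Rightarrow> 'b set" where
  "forward_orbit g x = {(g ^^ n) x | n. True}"

definition periodic_point :: "('b \<Rightarrow> 'b) \<Rightarrow> 'b \<Rightarrow> bool" where
  "periodic_point g p \<longleftrightarrow> (\<exists>n>0. (g ^^ n) p = p)"

definition chaotic_on :: "'b topology \<Rightarrow> ('b \<Rightarrow> 'b) \<Rightarrow> bool" where
  "chaotic_on X g \<longleftrightarrow>
     continuous_map X X g \<and>
     (\<forall>U V. openin X U \<and> U \<noteq> {} \<and> openin X V \<and> V \<noteq> {} \<longrightarrow>
        (\<exists>p \<in> topspace X. periodic_point g p \<and>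
           U \<inter> forward_orbit g p \<noteq> {} \<and> V \<inter> forward_orbit g p \<noteq> {}))"

end

theory Submission
  imports Defs
begin

text \<open>A basic neighbourhood of \<open>u\<close> only constrains coordinates \<open>x \<alpha> i\<close> with \<open>i \<le> n\<close>, for some \<open>n\<close>.
  Given such neighbourhoods of \<open>u\<close> and \<open>v\<close> with a common \<open>n\<close>, the point whose row \<open>\<alpha>\<close> repeats the word
  \<open>u (x \<alpha> 1) \<dots> u (x \<alpha> n) v (x \<alpha> 1) \<dots> v (x \<alpha> n)\<close> has period \<open>2 n\<close> and lies in the first neighbourhood,
  while its \<open>n\<close>-th iterate lies in the second.\<close>

text \<open>A basic set containing \<open>f\<close> is unchanged when its prescribed values are
  replaced by those of \<open>f\<close> on the same finite set. So neighbourhoods can be centred at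
  the point itself, and the map \<phi> disappears from later arguments.\<close>

lemma openin_cantor_topology_iff:
  "openin (cantor_topology A) U \<longleftrightarrow>
     U \<subseteq> cantor_space A \<and> (\<forall>f\<in>U. \<exists>B. finite B \<and> B \<subseteq> A \<and> cantor_nbhd A B f \<subseteq> U)"
    (is "?L \<longleftrightarrow> ?R")
proof
  assume L: ?L
  have "\<exists>B. finite B \<and> B \<subseteq> A \<and> cantor_nbhd A B f \<subseteq> U" if f: "f \<in> U" for f
  proof -
    obtain S where S: "S \<in> cantor_basis A" "f \<in> S" "S \<subseteq> U"
      using L f by (auto simp: openin_cantor_topology union_of_def)
    obtain B \<phi> where "S = cantor_nbhd A B \<phi>" "finite B" "B \<subseteq> A"
      using S(1) by (auto simp: cantor_basis_def)
    moreover from this have "cantor_nbhd A B f = S"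
      using S(2) by (auto simp: cantor_nbhd_def)
    ultimately show ?thesis using S(3) by blast
  qed
  then show ?R
    using openin_subset[OF L] by (simp add: topspace_cantor_topology)
next
  assume R: ?R
  have "\<exists>T. openin (cantor_topology A) T \<and> f \<in> T \<and> T \<subseteq> U" if f: "f \<in> U" for f
  proof -
    obtain B where B: "finite B" "B \<subseteq> A" "cantor_nbhd A B f \<subseteq> U"
      using R f by blast
    have fC: "f \<in> cantor_space A" using R f by blast
    \<comment> \<open>Members of \<open>cantor_basis\<close> come from extensional maps on
      \<open>B\<close>, so \<open>f\<close> has to be cut down to \<open>B\<close>; the
      neighbourhood does not notice.\<close>
    have "cantor_nbhd A B f = cantor_nbhd A B (restrict f B)"
      by (auto simp: cantor_nbhd_def)
    moreover have "restrict f B \<in> B \<rightarrow>\<^sub>E {0, 1}"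
      using fC B(2) by (auto simp: cantor_space_def PiE_iff)
    ultimately have "cantor_nbhd A B f \<in> cantor_basis A"
      using B(1,2) unfolding cantor_basis_def by blast
    then have "openin (cantor_topology A) (cantor_nbhd A B f)"
      by (simp add: openin_cantor_topology arbitrary_union_of_inc)
    moreover have "f \<in> cantor_nbhd A B f"
      using fC by (simp add: cantor_nbhd_def)
    ultimately show ?thesis using B(3) by blast
  qed
  then show ?L by (subst openin_subopen) blast
qed

lemma continuous_map_cantor_topology:
  assumes s: "s \<in> A \<rightarrow> A"
    and g: "g \<in> cantor_space A \<rightarrow> cantor_space A"
    and gs: "\<And>f a. f \<in> cantor_space A \<Longrightarrow> a \<in> A \<Longrightarrow> g f a = f (s a)"
  shows "continuous_map (cantor_topology A) (cantor_topology A) g"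
  unfolding continuous_map_def topspace_cantor_topology
proof (intro conjI allI impI g)
  fix U assume U: "openin (cantor_topology A) U"
  have "\<exists>B. finite B \<and> B \<subseteq> A \<and> cantor_nbhd A B f \<subseteq> {f \<in> cantor_space A. g f \<in> U}"
    if f: "f \<in> cantor_space A" "g f \<in> U" for f
  proof -
    obtain B where B: "finite B" "B \<subseteq> A" "cantor_nbhd A B (g f) \<subseteq> U"
      using U f(2) by (auto simp: openin_cantor_topology_iff)
    have "g h \<in> cantor_nbhd A B (g f)" if "h \<in> cantor_nbhd A (s ` B) f" for h
      using that f(1) B(2) g gs by (auto simp: cantor_nbhd_def subset_iff)
    then have "cantor_nbhd A (s ` B) f \<subseteq> {f \<in> cantor_space A. g f \<in> U}"
      using B(3) by (auto simp: cantor_nbhd_def)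
    moreover have "finite (s ` B)" "s ` B \<subseteq> A"
      using B(1,2) s by auto
    ultimately show ?thesis by blast
  qed
  then show "openin (cantor_topology A) {f \<in> cantor_space A. g f \<in> U}"
    by (auto simp: openin_cantor_topology_iff)
qed

theorem theorem2:
  fixes A :: "'a set" and I :: "'i set" and P :: "'i \<Rightarrow> 'a set"
    and x :: "'i \<Rightarrow> nat \<Rightarrow> 'a" and \<sigma> :: "('a \<Rightarrow> nat) \<Rightarrow> ('a \<Rightarrow> nat)"
  assumes "infinite A"
    and "A = (\<Union>\<alpha>\<in>I. P \<alpha>)"
    and "disjoint_family_on P I"
    and "\<And>\<alpha>. \<alpha> \<in> I \<Longrightarrow> bij_betw (x \<alpha>) {1..} (P \<alpha>)"
    and "\<sigma> \<in> cantor_space A \<rightarrow> cantor_space A"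
    and "\<And>f \<alpha> i. f \<in> cantor_space A \<Longrightarrow> \<alpha> \<in> I \<Longrightarrow> i \<ge> 1 \<Longrightarrow> \<sigma> f (x \<alpha> i) = f (x \<alpha> (i + 1))"
  shows "chaotic_on (cantor_topology A) \<sigma>"
proof -
  \<comment> \<open>Row and column of a point of \<open>A\<close>: disjointness makes the row
    unique, injectivity of the enumeration the column.\<close>
  define r where "r a = (THE \<alpha>. \<alpha> \<in> I \<and> a \<in> P \<alpha>)" for a
  define c where "c a = the_inv_into {1..} (x (r a)) a" for a
  have r: "r a = \<alpha>" if "\<alpha> \<in> I" "a \<in> P \<alpha>" for \<alpha> a
    unfolding r_def using that assms(3)
    by (intro the_equality) (auto simp: disjoint_family_on_def)
  have xP: "x \<alpha> i \<in> P \<alpha>" if "\<alpha> \<in> I" "i \<ge> 1" for \<alpha> i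
    using assms(4)[OF that(1)] that(2) by (auto simp: bij_betw_def)
  have xA: "x \<alpha> i \<in> A" if "\<alpha> \<in> I" "i \<ge> 1" for \<alpha> i
    using xP[OF that] that(1) assms(2) by blast
  have rx: "r (x \<alpha> i) = \<alpha>" if "\<alpha> \<in> I" "i \<ge> 1" for \<alpha> i
    using r xP that by blast
  have cx: "c (x \<alpha> i) = i" if "\<alpha> \<in> I" "i \<ge> 1" for \<alpha> i
    using assms(4)[OF that(1)] that(2) rx[OF that]
    by (simp add: c_def bij_betw_def the_inv_into_f_f)
  have coords: "r a \<in> I \<and> c a \<ge> 1 \<and> x (r a) (c a) = a" if a: "a \<in> A" for a
  proof -
    obtain \<alpha> where \<alpha>: "\<alpha> \<in> I" "a \<in> P \<alpha>" using a assms(2) by blast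
    then obtain i where "i \<ge> 1" "a = x \<alpha> i"
      using assms(4)[OF \<alpha>(1)] by (auto simp: bij_betw_def)
    then show ?thesis using \<alpha>(1) rx cx by simp
  qed

  have cont: "continuous_map (cantor_topology A) (cantor_topology A) \<sigma>"
  proof (rule continuous_map_cantor_topology)
    \<comment> \<open>The reindexing behind \<sigma> is the successor within a row.\<close>
    show "(\<lambda>a. x (r a) (c a + 1)) \<in> A \<rightarrow> A"
      using coords xA by auto
    show "\<sigma> f a = f (x (r a) (c a + 1))" if "f \<in> cantor_space A" "a \<in> A" for f a
      using assms(6)[OF that(1), of "r a" "c a"] coords[OF that(2)] by simp
  qed (rule assms(5))

  have iterC: "(\<sigma> ^^ n) f \<in> cantor_space A" if "f \<in> cantor_space A" for f n
    using that assms(5) by (induction n) auto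
  \<comment> \<open>The outermost \<sigma> raises the index by one, so the induction hypothesis is
    needed at \<open>i + 1\<close>; \<open>iterC\<close> is what allows the shift rule to be applied
    to an iterate.\<close>
  have iter: "(\<sigma> ^^ n) f (x \<alpha> i) = f (x \<alpha> (i + n))"
    if "f \<in> cantor_space A" "\<alpha> \<in> I" "i \<ge> 1" for f \<alpha> i n
    using that(3)
  proof (induction n arbitrary: i)
    case (Suc n)
    then show ?case
      using assms(6)[OF iterC[OF that(1)] that(2)] by simp
  qed simp

  have "\<exists>p \<in> cantor_space A. periodic_point \<sigma> p \<and>
      U \<inter> forward_orbit \<sigma> p \<noteq> {} \<and> V \<inter> forward_orbit \<sigma> p \<noteq> {}"
    if U: "openin (cantor_topology A) U" "U \<noteq> {}"
      and V: "openin (cantor_topology A) V" "V \<noteq> {}" for U V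
  proof -
    obtain u where "u \<in> U" using U(2) by blast
    then obtain B where u: "u \<in> cantor_space A"
      and B: "finite B" "B \<subseteq> A" "cantor_nbhd A B u \<subseteq> U"
      using U(1) unfolding openin_cantor_topology_iff by blast
    obtain v where "v \<in> V" using V(2) by blast
    then obtain D where v: "v \<in> cantor_space A"
      and D: "finite D" "D \<subseteq> A" "cantor_nbhd A D v \<subseteq> V"
      using V(1) unfolding openin_cantor_topology_iff by blast
    \<comment> \<open>A common bound for the columns met by \<open>B\<close> and \<open>D\<close>.
      The inserted 0 covers the case that both are empty, and \<open>Suc\<close> makes the period
      \<open>2 * n\<close> positive.\<close>
    define n where "n = Suc (Max (insert 0 (c ` (B \<union> D))))"
    have n: "n > 0" by (simp add: n_def)
    have cn: "c a \<le> n" if "a \<in> B \<union> D" for a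
      unfolding n_def using that B(1) D(1) by (intro le_SucI Max_ge) auto
    \<comment> \<open>Positions in the word start at 0 but columns start at 1, hence the
      \<open>+ 1\<close> here and the \<open>c a - 1\<close> in \<open>p\<close>.\<close>
    define w where "w \<alpha> j = (if j < n then u (x \<alpha> (j + 1)) else v (x \<alpha> (j - n + 1)))" for \<alpha> j
    define p where "p = (\<lambda>a\<in>A. w (r a) ((c a - 1) mod (2 * n)))"
    have w01: "w \<alpha> j \<in> {0, 1}" if "\<alpha> \<in> I" for \<alpha> j
      using u v xA[OF that] by (auto simp: w_def cantor_space_def PiE_iff)
    have p: "p \<in> cantor_space A"
      unfolding cantor_space_def p_def using w01 coords by (intro restrict_PiE_iff[THEN iffD2]) blast
    have px: "p (x \<alpha> i) = w \<alpha> ((i - 1) mod (2 * n))" if "\<alpha> \<in> I" "i \<ge> 1" for \<alpha> i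
      using that xA rx cx by (simp add: p_def)
    have "(\<sigma> ^^ (2 * n)) p = p"
    proof (rule PiE_ext)
      show "(\<sigma> ^^ (2 * n)) p \<in> A \<rightarrow>\<^sub>E {0, 1}" "p \<in> A \<rightarrow>\<^sub>E {0, 1}"
        using p iterC by (auto simp: cantor_space_def)
      fix a assume "a \<in> A"
      then obtain \<alpha> i where a: "\<alpha> \<in> I" "i \<ge> 1" "a = x \<alpha> i"
        using coords by metis
      \<comment> \<open>Subtraction is truncated: \<open>i \<ge> 1\<close> is what lets the
        \<open>- 1\<close> move past \<open>2 * n\<close>.\<close>
      have "(i + 2 * n - 1) mod (2 * n) = (i - 1) mod (2 * n)"
        using a(2) by (metis Nat.add_diff_assoc2 mod_add_self2)
      then show "(\<sigma> ^^ (2 * n)) p a = p a"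
        using iter[OF p a(1,2)] px a by simp
    qed
    then have "periodic_point \<sigma> p"
      unfolding periodic_point_def using n by (intro exI[of _ "2 * n"]) simp
    moreover have "p a = u a" if "a \<in> B" for a
    proof -
      have a: "r a \<in> I" "c a \<ge> 1" "x (r a) (c a) = a" "c a \<le> n"
        using that B(2) coords cn by auto
      \<comment> \<open>The position falls in the first half of the word, where \<open>u\<close> is
        copied.\<close>
      then have "c a - 1 < n" "c a - 1 + 1 = c a" by auto
      then show ?thesis
        using px[OF a(1,2)] a(3) by (simp add: w_def)
    qed
    then have "(\<sigma> ^^ 0) p \<in> U"
      using p B(3) by (auto simp: cantor_nbhd_def)
    moreover have "(\<sigma> ^^ n) p a = v a" if "a \<in> D" for a
    proof -
      have a: "r a \<in> I" "c a \<ge> 1" "x (r a) (c a) = a" "c a \<le> n"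
        using that D(2) coords cn by auto
      \<comment> \<open>From 1 \<le> \<open>c a\<close> \<le> \<open>n\<close> the position lies
        between \<open>n\<close> and \<open>2 * n - 1\<close>: there is no wrap-around, and the
        second half of the word returns \<open>v\<close> at column \<open>c a\<close>.\<close>
      then have "(c a + n - 1) mod (2 * n) = c a + n - 1"
          "\<not> c a + n - 1 < n" "c a + n - 1 - n + 1 = c a"
        by auto
      then show ?thesis
        using iter[OF p a(1,2), of n] px[OF a(1), of "c a + n"] a(2,3) by (simp add: w_def)
    qed
    then have "(\<sigma> ^^ n) p \<in> V"
      using iterC[OF p] D(3) by (auto simp: cantor_nbhd_def)
    ultimately show ?thesis
      using p unfolding forward_orbit_def by blast
  qed
  with cont show ?thesis
    by (simp add: chaotic_on_def topspace_cantor_topology)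
qed

end
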